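(* Let $\mathcal{C}$ be a $\mathcal{V}$-enriched and tensored category, let $A,B\in\mathcal{C}$ be objects and let $\mathcal{M}$ be a multispan on $(A,B)$. Then the category of coalgebras in $\mathcal{V}$ measuring $\mathcal{M}$ has a terminal object $M(\mathcal{M})$.
   Context: $\mathcal{V}$ is a symmetric monoidal category that is closed (the functors $x\otimes-$ are left adjoints), complete, cocomplete and locally presentable, and such that moreover: the forgetful functor $\mathrm{Coalg}_{\mathcal{V}}\to\mathcal{V}$ from (counital, coassociative) coalgebras in $\mathcal{V}$ has a right adjoint; $\mathrm{Coalg}_{\mathcal{V}}$ is complete, cocomplete and locally presentable; and the inclusion of Hopf algebras in $\mathcal{V}$ into bialgebras in $\mathcal{V}$ has a right adjoint. A $\mathcal{V}$-enriched category $\mathcal{C}$ (with hom-objects $\hom(c,d)\in\mathcal{V}$) is tensored if for every $c\in\mathcal{C}$ the functor $d\mapsto\hom(c,d)$, $\mathcal{C}\to\mathcal{V}$, has a left adjoint $-\otimes c$. A span on $(A,B)$ of shape $(l,r)$, with $l,r\ge 0$ integers, is a pair of morphisms in $\mathcal{V}$ $$\hom(A,B)^{\otimes l}\xrightarrow{\ s\ }T\xleftarrow{\ t\ }\hom(A,B)^{\otimes r}$$ with common target some object $T\in\mathcal{V}$, where the $0$-th tensor power is the monoidal unit. A multispan on $(A,B)$ is a tuple of such spans. A coalgebra $C$ in $\mathcal{V}$ measures $\mathcal{M}$ via a morphism $\psi:C\to\hom(A,B)$ in $\mathcal{V}$ if for each span $(s,t)$ in $\mathcal{M}$ of shape $(l,r)$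 one has $s\circ\psi^{\otimes l}\circ\Delta^{(l)}=t\circ\psi^{\otimes r}\circ\Delta^{(r)}$ as morphisms $C\to T$, where $\Delta^{(n)}:C\to C^{\otimes n}$ is the iterated comultiplication ($\Delta^{(0)}$ is the counit, $\Delta^{(1)}=\mathrm{id}$). The category of coalgebras measuring $\mathcal{M}$ has such pairs $(C,\psi)$ as objects, and as morphisms $(C,\psi)\to(C',\psi')$ the coalgebra morphisms $f:C\to C'$ with $\psi'\circ f=\psi$. *)

theory Defs
  imports "HOL-Library.FuncSet"
begin

unbundle cardinal_syntax

section \<open>Categories, functors, adjunctions\<close>

record ('o, 'a) cat =
  Obj :: "'o set"
  Arr :: "'a set"
  Dom :: "'a \<Rightarrow> 'o"
  Cod :: "'a \<Rightarrow> 'o"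
  Id :: "'o \<Rightarrow> 'a"
  Comp :: "'a \<Rightarrow> 'a \<Rightarrow> 'a" (infixr \<open>\<cdot>\<index>\<close> 65)

definition hom :: "('o, 'a, 'z) cat_scheme \<Rightarrow> 'o \<Rightarrow> 'o \<Rightarrow> 'a set" where
  "hom C a b = {f \<in> Arr C. Dom C f = a \<and> Cod C f = b}"

locale category =
  fixes C :: "('o, 'a, 'z) cat_scheme" (structure)
  assumes dom_obj: "f \<in> Arr C \<Longrightarrow> Dom C f \<in> Obj C"
    and cod_obj: "f \<in> Arr C \<Longrightarrow> Cod C f \<in> Obj C"
    and id_hom: "a \<in> Obj C \<Longrightarrow> Id C a \<in> hom C a a"
    and comp_hom: "f \<in> hom C a b \<Longrightarrow> g \<in> hom C b c \<Longrightarrow> g \<cdot> f \<in> hom C a c"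
    and comp_id: "f \<in> hom C a b \<Longrightarrow> f \<cdot> Id C a = f"
    and id_comp: "f \<in> hom C a b \<Longrightarrow> Id C b \<cdot> f = f"
    and comp_assoc:
      "f \<in> hom C a b \<Longrightarrow> g \<in> hom C b c \<Longrightarrow> h \<in> hom C c d \<Longrightarrow> (h \<cdot> g) \<cdot> f = h \<cdot> (g \<cdot> f)"

definition inverse_arrows :: "('o, 'a, 'z) cat_scheme \<Rightarrow> 'a \<Rightarrow> 'a \<Rightarrow> bool" where
  "inverse_arrows C f g \<longleftrightarrow> f \<in> Arr C \<and> g \<in> hom C (Cod C f) (Dom C f) \<and>
     Comp C g f = Id C (Dom C f) \<and> Comp C f g = Id C (Cod C f)"

definition iso :: "('o, 'a, 'z) cat_scheme \<Rightarrow> 'a \<Rightarrow> bool" where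
  "iso C f \<longleftrightarrow> (\<exists>g. inverse_arrows C f g)"

definition inv_arr :: "('o, 'a, 'z) cat_scheme \<Rightarrow> 'a \<Rightarrow> 'a" where
  "inv_arr C f = (THE g. inverse_arrows C f g)"

definition terminal :: "('o, 'a, 'z) cat_scheme \<Rightarrow> 'o \<Rightarrow> bool" where
  "terminal C x \<longleftrightarrow> x \<in> Obj C \<and> (\<forall>y \<in> Obj C. \<exists>!f. f \<in> hom C y x)"

record ('o, 'a, 'p, 'b) func =
  OMap :: "'o \<Rightarrow> 'p"
  AMap :: "'a \<Rightarrow> 'b"

definition is_functor ::
    "('o, 'a, 'z) cat_scheme \<Rightarrow> ('p, 'b, 'y) cat_scheme \<Rightarrow> ('o, 'a, 'p, 'b) func \<Rightarrow> bool" where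
  "is_functor C D F \<longleftrightarrow> category C \<and> category D \<and>
     (\<forall>a \<in> Obj C. OMap F a \<in> Obj D) \<and>
     (\<forall>f \<in> Arr C. AMap F f \<in> hom D (OMap F (Dom C f)) (OMap F (Cod C f))) \<and>
     (\<forall>a \<in> Obj C. AMap F (Id C a) = Id D (OMap F a)) \<and>
     (\<forall>f \<in> Arr C. \<forall>g \<in> Arr C. Cod C f = Dom C g \<longrightarrow>
        AMap F (Comp C g f) = Comp D (AMap F g) (AMap F f))"

definition comp_func ::
    "('p, 'b, 'q, 'c) func \<Rightarrow> ('o, 'a, 'p, 'b) func \<Rightarrow> ('o, 'a, 'q, 'c) func" where
  "comp_func G F = \<lparr>OMap = OMap G \<circ> OMap F, AMap = AMap G \<circ> AMap F\<rparr>"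

definition inclusion_func :: "('o, 'a, 'o, 'a) func" where
  "inclusion_func = \<lparr>OMap = (\<lambda>x. x), AMap = (\<lambda>f. f)\<rparr>"

text \<open>\<open>F : C \<rightarrow> D\<close> is left adjoint to \<open>G : D \<rightarrow> C\<close>.\<close>

definition adjunction ::
    "('o, 'a, 'z) cat_scheme \<Rightarrow> ('p, 'b, 'y) cat_scheme \<Rightarrow>
     ('o, 'a, 'p, 'b) func \<Rightarrow> ('p, 'b, 'o, 'a) func \<Rightarrow> bool" where
  "adjunction C D F G \<longleftrightarrow> is_functor C D F \<and> is_functor D C G \<and>
     (\<exists>\<phi>. (\<forall>c \<in> Obj C. \<forall>d \<in> Obj D.
              bij_betw (\<phi> c d) (hom D (OMap F c) d) (hom C c (OMap G d))) \<and>
          (\<forall>c \<in> Obj C. \<forall>c' \<in> Obj C. \<forall>d \<in> Obj D. \<forall>d' \<in> Obj D.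
             \<forall>u \<in> hom C c' c. \<forall>v \<in> hom D d d'. \<forall>f \<in> hom D (OMap F c) d.
               \<phi> c' d' (Comp D v (Comp D f (AMap F u)))
                 = Comp C (AMap G v) (Comp C (\<phi> c d f) u)))"

definition has_right_adjoint ::
    "('o, 'a, 'z) cat_scheme \<Rightarrow> ('p, 'b, 'y) cat_scheme \<Rightarrow> ('o, 'a, 'p, 'b) func \<Rightarrow> bool" where
  "has_right_adjoint C D F \<longleftrightarrow> (\<exists>G. adjunction C D F G)"

definition has_left_adjoint ::
    "('p, 'b, 'y) cat_scheme \<Rightarrow> ('o, 'a, 'z) cat_scheme \<Rightarrow> ('p, 'b, 'o, 'a) func \<Rightarrow> bool" where
  "has_left_adjoint D C G \<longleftrightarrow> (\<exists>F. adjunction C D F G)"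


section \<open>Limits, colimits, local presentability\<close>

text \<open>
  Sizes are measured by a type \<open>'u\<close>: a set is small if its cardinality is strictly below that of
  \<open>'u\<close>.  If the cardinality of \<open>'u\<close> is inaccessible, the small sets are, up to bijection, the
  elements of a Grothendieck universe; no closure property of \<open>'u\<close> is built into the
  definitions.  A small category is isomorphic to one whose objects and arrows are taken from
  \<open>'u\<close>, so the shapes of diagrams are of this form.
\<close>

definition small :: "'u itself \<Rightarrow> 'x set \<Rightarrow> bool" where
  "small U S \<longleftrightarrow> |S| <o |UNIV :: 'u set|"

definition small_cat :: "('u, 'u) cat \<Rightarrow> bool" where
  "small_cat J \<longleftrightarrow> category J \<and> small TYPE('u) (Arr J)"

definition is_cone ::
    "('j, 'k, 'y) cat_scheme \<Rightarrow> ('o, 'a, 'z) cat_scheme \<Rightarrow> ('j, 'k, 'o, 'a) func \<Rightarrow>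
     'o \<Rightarrow> ('j \<Rightarrow> 'a) \<Rightarrow> bool" where
  "is_cone J C D x p \<longleftrightarrow> x \<in> Obj C \<and> (\<forall>j \<in> Obj J. p j \<in> hom C x (OMap D j)) \<and>
     (\<forall>u \<in> Arr J. Comp C (AMap D u) (p (Dom J u)) = p (Cod J u))"

definition is_limit ::
    "('j, 'k, 'y) cat_scheme \<Rightarrow> ('o, 'a, 'z) cat_scheme \<Rightarrow> ('j, 'k, 'o, 'a) func \<Rightarrow>
     'o \<Rightarrow> ('j \<Rightarrow> 'a) \<Rightarrow> bool" where
  "is_limit J C D x p \<longleftrightarrow> is_cone J C D x p \<and>
     (\<forall>y q. is_cone J C D y q \<longrightarrow>
        (\<exists>!h. h \<in> hom C y x \<and> (\<forall>j \<in> Obj J. Comp C (p j) h = q j)))"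

definition is_cocone ::
    "('j, 'k, 'y) cat_scheme \<Rightarrow> ('o, 'a, 'z) cat_scheme \<Rightarrow> ('j, 'k, 'o, 'a) func \<Rightarrow>
     'o \<Rightarrow> ('j \<Rightarrow> 'a) \<Rightarrow> bool" where
  "is_cocone J C D x i \<longleftrightarrow> x \<in> Obj C \<and> (\<forall>j \<in> Obj J. i j \<in> hom C (OMap D j) x) \<and>
     (\<forall>u \<in> Arr J. Comp C (i (Cod J u)) (AMap D u) = i (Dom J u))"

definition is_colimit ::
    "('j, 'k, 'y) cat_scheme \<Rightarrow> ('o, 'a, 'z) cat_scheme \<Rightarrow> ('j, 'k, 'o, 'a) func \<Rightarrow>
     'o \<Rightarrow> ('j \<Rightarrow> 'a) \<Rightarrow> bool" where
  "is_colimit J C D x i \<longleftrightarrow> is_cocone J C D x i \<and>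
     (\<forall>y q. is_cocone J C D y q \<longrightarrow>
        (\<exists>!h. h \<in> hom C x y \<and> (\<forall>j \<in> Obj J. Comp C h (i j) = q j)))"

definition complete :: "'u itself \<Rightarrow> ('o, 'a, 'z) cat_scheme \<Rightarrow> bool" where
  "complete U C \<longleftrightarrow> category C \<and>
     (\<forall>(J :: ('u, 'u) cat) D. small_cat J \<and> is_functor J C D \<longrightarrow> (\<exists>x p. is_limit J C D x p))"

definition cocomplete :: "'u itself \<Rightarrow> ('o, 'a, 'z) cat_scheme \<Rightarrow> bool" where
  "cocomplete U C \<longleftrightarrow> category C \<and>
     (\<forall>(J :: ('u, 'u) cat) D. small_cat J \<and> is_functor J C D \<longrightarrow> (\<exists>x i. is_colimit J C D x i))"

definition locally_small :: "'u itself \<Rightarrow> ('o, 'a, 'z) cat_scheme \<Rightarrow> bool" where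
  "locally_small U C \<longleftrightarrow> category C \<and> (\<forall>a \<in> Obj C. \<forall>b \<in> Obj C. small U (hom C a b))"

text \<open>
  The category of all sets of elements of the type \<open>'s\<close>, the target of the functors
  \<open>hom(K, -)\<close>.  Since a map of sets is bijective as soon as precomposition with it is bijective on
  maps into a two-element set, it does not matter for the preservation of a colimit by
  \<open>hom(K, -)\<close> that the universal property is tested on sets over \<open>'s\<close> only.
\<close>

definition Sets :: "('s set, 's set \<times> 's set \<times> ('s \<Rightarrow> 's)) cat" where
  "Sets = \<lparr>Obj = UNIV, Arr = {(X, Y, f). f \<in> X \<rightarrow>\<^sub>E Y},
     Dom = (\<lambda>(X, Y, f). X), Cod = (\<lambda>(X, Y, f). Y),
     Id = (\<lambda>X. (X, X, restrict (\<lambda>x. x) X)),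
     Comp = (\<lambda>(Y, Z, g) (X, Y', f). (X, Z, compose X g f))\<rparr>"

definition hom_func ::
    "('o, 'a, 'z) cat_scheme \<Rightarrow> 'o \<Rightarrow> ('o, 'a, 'a set, 'a set \<times> 'a set \<times> ('a \<Rightarrow> 'a)) func" where
  "hom_func C K = \<lparr>OMap = hom C K,
     AMap = (\<lambda>f. (hom C K (Dom C f), hom C K (Cod C f), \<lambda>g \<in> hom C K (Dom C f). Comp C f g))\<rparr>"

text \<open>A category that is a \<open>\<lambda>\<close>-directed poset (nonempty by the case \<open>S = {}\<close>).\<close>

definition directed_poset :: "'l rel \<Rightarrow> ('j, 'k, 'y) cat_scheme \<Rightarrow> bool" where
  "directed_poset l J \<longleftrightarrow> category J \<and>
     (\<forall>i j f g. f \<in> hom J i j \<and> g \<in> hom J i j \<longrightarrow> f = g) \<and>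
     (\<forall>i j. hom J i j \<noteq> {} \<and> hom J j i \<noteq> {} \<longrightarrow> i = j) \<and>
     (\<forall>S \<subseteq> Obj J. |S| <o l \<longrightarrow> (\<exists>u \<in> Obj J. \<forall>s \<in> S. hom J s u \<noteq> {}))"

definition presentable :: "'u itself \<Rightarrow> 'u rel \<Rightarrow> ('o, 'a, 'z) cat_scheme \<Rightarrow> 'o \<Rightarrow> bool" where
  "presentable U l C K \<longleftrightarrow> K \<in> Obj C \<and>
     (\<forall>(J :: ('u, 'u) cat) D x i.
        small_cat J \<and> directed_poset l J \<and> is_functor J C D \<and> is_colimit J C D x i \<longrightarrow>
        is_colimit J Sets (comp_func (hom_func C K) D)
          (OMap (hom_func C K) x) (\<lambda>j. AMap (hom_func C K) (i j)))"

definition locally_presentable :: "'u itself \<Rightarrow> ('o, 'a, 'z) cat_scheme \<Rightarrow> bool" where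
  "locally_presentable U C \<longleftrightarrow> cocomplete U C \<and> locally_small U C \<and>
     (\<exists>l :: 'u rel. Card_order l \<and> cinfinite l \<and> regularCard l \<and> l <o |UNIV :: 'u set| \<and>
        (\<exists>S \<subseteq> Obj C. small U S \<and> (\<forall>K \<in> S. presentable U l C K) \<and>
           (\<forall>x \<in> Obj C. \<exists>(J :: ('u, 'u) cat) D i.
              small_cat J \<and> directed_poset l J \<and> is_functor J C D \<and>
              (\<forall>j \<in> Obj J. OMap D j \<in> S) \<and> is_colimit J C D x i)))"


section \<open>Symmetric monoidal closed categories\<close>

record ('o, 'a) smcat = "('o, 'a) cat" +
  Tens :: "'o \<Rightarrow> 'o \<Rightarrow> 'o" (infixr \<open>\<otimes>\<index>\<close> 70)
  TensA :: "'a \<Rightarrow> 'a \<Rightarrow> 'a" (infixr \<open>\<odot>\<index>\<close> 70)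
  Unit :: "'o" (\<open>\<one>\<index>\<close>)
  Assoc :: "'o \<Rightarrow> 'o \<Rightarrow> 'o \<Rightarrow> 'a"
  Lunit :: "'o \<Rightarrow> 'a"
  Runit :: "'o \<Rightarrow> 'a"
  Braid :: "'o \<Rightarrow> 'o \<Rightarrow> 'a"

locale symmetric_monoidal = category V
  for V :: "('o, 'a, 'z) smcat_scheme" (structure) +
  assumes tens_obj: "a \<in> Obj V \<Longrightarrow> b \<in> Obj V \<Longrightarrow> a \<otimes> b \<in> Obj V"
    and unit_obj: "\<one> \<in> Obj V"
    and tens_hom: "f \<in> hom V a b \<Longrightarrow> g \<in> hom V c d \<Longrightarrow> f \<odot> g \<in> hom V (a \<otimes> c) (b \<otimes> d)"
    and tens_id: "a \<in> Obj V \<Longrightarrow> b \<in> Obj V \<Longrightarrow> Id V a \<odot> Id V b = Id V (a \<otimes> b)"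
    and tens_comp:
      "f \<in> hom V a b \<Longrightarrow> f' \<in> hom V b c \<Longrightarrow> g \<in> hom V a' b' \<Longrightarrow> g' \<in> hom V b' c' \<Longrightarrow>
       (f' \<cdot> f) \<odot> (g' \<cdot> g) = (f' \<odot> g') \<cdot> (f \<odot> g)"
    and assoc_hom: "a \<in> Obj V \<Longrightarrow> b \<in> Obj V \<Longrightarrow> c \<in> Obj V \<Longrightarrow>
       Assoc V a b c \<in> hom V ((a \<otimes> b) \<otimes> c) (a \<otimes> (b \<otimes> c))"
    and assoc_iso: "a \<in> Obj V \<Longrightarrow> b \<in> Obj V \<Longrightarrow> c \<in> Obj V \<Longrightarrow> iso V (Assoc V a b c)"
    and assoc_natural:
      "f \<in> hom V a a' \<Longrightarrow> g \<in> hom V b b' \<Longrightarrow> h \<in> hom V c c' \<Longrightarrow>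
       Assoc V a' b' c' \<cdot> ((f \<odot> g) \<odot> h) = (f \<odot> (g \<odot> h)) \<cdot> Assoc V a b c"
    and lunit_hom: "a \<in> Obj V \<Longrightarrow> Lunit V a \<in> hom V (\<one> \<otimes> a) a"
    and lunit_iso: "a \<in> Obj V \<Longrightarrow> iso V (Lunit V a)"
    and lunit_natural: "f \<in> hom V a b \<Longrightarrow> Lunit V b \<cdot> (Id V \<one> \<odot> f) = f \<cdot> Lunit V a"
    and runit_hom: "a \<in> Obj V \<Longrightarrow> Runit V a \<in> hom V (a \<otimes> \<one>) a"
    and runit_iso: "a \<in> Obj V \<Longrightarrow> iso V (Runit V a)"
    and runit_natural: "f \<in> hom V a b \<Longrightarrow> Runit V b \<cdot> (f \<odot> Id V \<one>) = f \<cdot> Runit V a"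
    and braid_hom: "a \<in> Obj V \<Longrightarrow> b \<in> Obj V \<Longrightarrow> Braid V a b \<in> hom V (a \<otimes> b) (b \<otimes> a)"
    and braid_natural: "f \<in> hom V a a' \<Longrightarrow> g \<in> hom V b b' \<Longrightarrow>
       Braid V a' b' \<cdot> (f \<odot> g) = (g \<odot> f) \<cdot> Braid V a b"
    and pentagon: "a \<in> Obj V \<Longrightarrow> b \<in> Obj V \<Longrightarrow> c \<in> Obj V \<Longrightarrow> d \<in> Obj V \<Longrightarrow>
       (Id V a \<odot> Assoc V b c d) \<cdot> Assoc V a (b \<otimes> c) d \<cdot> (Assoc V a b c \<odot> Id V d)
         = Assoc V a b (c \<otimes> d) \<cdot> Assoc V (a \<otimes> b) c d"
    and triangle: "a \<in> Obj V \<Longrightarrow> b \<in> Obj V \<Longrightarrow>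
       (Id V a \<odot> Lunit V b) \<cdot> Assoc V a \<one> b = Runit V a \<odot> Id V b"
    and hexagon: "a \<in> Obj V \<Longrightarrow> b \<in> Obj V \<Longrightarrow> c \<in> Obj V \<Longrightarrow>
       Assoc V b c a \<cdot> Braid V a (b \<otimes> c) \<cdot> Assoc V a b c
         = (Id V b \<odot> Braid V a c) \<cdot> Assoc V b a c \<cdot> (Braid V a b \<odot> Id V c)"
    and symmetry: "a \<in> Obj V \<Longrightarrow> b \<in> Obj V \<Longrightarrow> Braid V b a \<cdot> Braid V a b = Id V (a \<otimes> b)"

definition tensor_func :: "('o, 'a, 'z) smcat_scheme \<Rightarrow> 'o \<Rightarrow> ('o, 'a, 'o, 'a) func" where
  "tensor_func V x = \<lparr>OMap = (\<lambda>y. Tens V x y), AMap = (\<lambda>f. TensA V (Id V x) f)\<rparr>"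

definition closed_monoidal :: "('o, 'a, 'z) smcat_scheme \<Rightarrow> bool" where
  "closed_monoidal V \<longleftrightarrow> (\<forall>x \<in> Obj V. has_right_adjoint V V (tensor_func V x))"

text \<open>Tensor powers, bracketed to the right.\<close>

fun tpow :: "('o, 'a, 'z) smcat_scheme \<Rightarrow> nat \<Rightarrow> 'o \<Rightarrow> 'o" where
  "tpow V 0 x = Unit V"
| "tpow V (Suc 0) x = x"
| "tpow V (Suc (Suc n)) x = Tens V x (tpow V (Suc n) x)"

fun tpow_arr :: "('o, 'a, 'z) smcat_scheme \<Rightarrow> nat \<Rightarrow> 'a \<Rightarrow> 'a" where
  "tpow_arr V 0 f = Id V (Unit V)"
| "tpow_arr V (Suc 0) f = f"
| "tpow_arr V (Suc (Suc n)) f = TensA V f (tpow_arr V (Suc n) f)"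

text \<open>
  \<open>mid4 V a b c d : (a \<otimes> b) \<otimes> (c \<otimes> d) \<rightarrow> (a \<otimes> c) \<otimes> (b \<otimes> d)\<close> exchanges the two middle factors.
\<close>

definition mid4 :: "('o, 'a, 'z) smcat_scheme \<Rightarrow> 'o \<Rightarrow> 'o \<Rightarrow> 'o \<Rightarrow> 'o \<Rightarrow> 'a" where
  "mid4 V a b c d =
     inv_arr V (Assoc V a c (b \<otimes>\<^bsub>V\<^esub> d)) \<cdot>\<^bsub>V\<^esub>
     (Id V a \<odot>\<^bsub>V\<^esub>
        (Assoc V c b d \<cdot>\<^bsub>V\<^esub> (Braid V b c \<odot>\<^bsub>V\<^esub> Id V d) \<cdot>\<^bsub>V\<^esub> inv_arr V (Assoc V b c d))) \<cdot>\<^bsub>V\<^esub>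
     Assoc V a b (c \<otimes>\<^bsub>V\<^esub> d)"


section \<open>Coalgebras, bialgebras, Hopf algebras\<close>

text \<open>
  The category of structured objects of \<open>V\<close>: its objects are the elements of \<open>S\<close>, with underlying
  objects given by \<open>U\<close>, and its arrows \<open>x \<rightarrow> y\<close> are the arrows \<open>U x \<rightarrow> U y\<close> of \<open>V\<close> that satisfy
  \<open>P x y\<close>, tagged with \<open>x\<close> and \<open>y\<close>.
\<close>

definition structured_cat ::
    "('o, 'a, 'z) cat_scheme \<Rightarrow> 'x set \<Rightarrow> ('x \<Rightarrow> 'o) \<Rightarrow> ('x \<Rightarrow> 'x \<Rightarrow> 'a \<Rightarrow> bool) \<Rightarrow>
     ('x, 'x \<times> 'x \<times> 'a) cat" where
  "structured_cat V S U P =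
     \<lparr>Obj = S,
      Arr = {(x, y, f). x \<in> S \<and> y \<in> S \<and> f \<in> hom V (U x) (U y) \<and> P x y f},
      Dom = (\<lambda>(x, y, f). x), Cod = (\<lambda>(x, y, f). y),
      Id = (\<lambda>x. (x, x, Id V (U x))),
      Comp = (\<lambda>(y, z, g) (x, y', f). (x, z, Comp V g f))\<rparr>"

record ('o, 'a) coalg =
  Carr :: "'o"
  Comult :: "'a"
  Counit :: "'a"

definition is_coalg :: "('o, 'a, 'z) smcat_scheme \<Rightarrow> ('o, 'a, 'y) coalg_scheme \<Rightarrow> bool" where
  "is_coalg V C \<longleftrightarrow> (let c = Carr C; \<Delta> = Comult C; \<epsilon> = Counit C in
     c \<in> Obj V \<and> \<Delta> \<in> hom V c (c \<otimes>\<^bsub>V\<^esub> c) \<and> \<epsilon> \<in> hom V c \<one>\<^bsub>V\<^esub> \<and>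
     Assoc V c c c \<cdot>\<^bsub>V\<^esub> (\<Delta> \<odot>\<^bsub>V\<^esub> Id V c) \<cdot>\<^bsub>V\<^esub> \<Delta> = (Id V c \<odot>\<^bsub>V\<^esub> \<Delta>) \<cdot>\<^bsub>V\<^esub> \<Delta> \<and>
     Lunit V c \<cdot>\<^bsub>V\<^esub> (\<epsilon> \<odot>\<^bsub>V\<^esub> Id V c) \<cdot>\<^bsub>V\<^esub> \<Delta> = Id V c \<and>
     Runit V c \<cdot>\<^bsub>V\<^esub> (Id V c \<odot>\<^bsub>V\<^esub> \<epsilon>) \<cdot>\<^bsub>V\<^esub> \<Delta> = Id V c)"

definition is_coalg_hom ::
    "('o, 'a, 'z) smcat_scheme \<Rightarrow> ('o, 'a, 'x) coalg_scheme \<Rightarrow> ('o, 'a, 'y) coalg_scheme \<Rightarrow>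
     'a \<Rightarrow> bool" where
  "is_coalg_hom V C D f \<longleftrightarrow> f \<in> hom V (Carr C) (Carr D) \<and>
     Comult D \<cdot>\<^bsub>V\<^esub> f = (f \<odot>\<^bsub>V\<^esub> f) \<cdot>\<^bsub>V\<^esub> Comult C \<and> Counit D \<cdot>\<^bsub>V\<^esub> f = Counit C"

definition Coalg ::
    "('o, 'a, 'z) smcat_scheme \<Rightarrow>
     (('o, 'a) coalg, ('o, 'a) coalg \<times> ('o, 'a) coalg \<times> 'a) cat" where
  "Coalg V = structured_cat V {C. is_coalg V C} Carr (is_coalg_hom V)"

definition forget_coalg ::
    "(('o, 'a) coalg, ('o, 'a) coalg \<times> ('o, 'a) coalg \<times> 'a, 'o, 'a) func" where
  "forget_coalg = \<lparr>OMap = Carr, AMap = (\<lambda>(C, D, f). f)\<rparr>"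

text \<open>The iterated comultiplication \<open>C \<rightarrow> C\<^sup>\<otimes>\<^sup>n\<close>.\<close>

fun iter_comult :: "('o, 'a, 'z) smcat_scheme \<Rightarrow> ('o, 'a) coalg \<Rightarrow> nat \<Rightarrow> 'a" where
  "iter_comult V C 0 = Counit C"
| "iter_comult V C (Suc 0) = Id V (Carr C)"
| "iter_comult V C (Suc (Suc n)) =
     (Id V (Carr C) \<odot>\<^bsub>V\<^esub> iter_comult V C (Suc n)) \<cdot>\<^bsub>V\<^esub> Comult C"

definition tensor_coalg ::
    "('o, 'a, 'z) smcat_scheme \<Rightarrow> ('o, 'a, 'x) coalg_scheme \<Rightarrow> ('o, 'a, 'y) coalg_scheme \<Rightarrow>
     ('o, 'a) coalg" where
  "tensor_coalg V C D = \<lparr>Carr = Carr C \<otimes>\<^bsub>V\<^esub> Carr D,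
     Comult = mid4 V (Carr C) (Carr C) (Carr D) (Carr D) \<cdot>\<^bsub>V\<^esub> (Comult C \<odot>\<^bsub>V\<^esub> Comult D),
     Counit = Lunit V \<one>\<^bsub>V\<^esub> \<cdot>\<^bsub>V\<^esub> (Counit C \<odot>\<^bsub>V\<^esub> Counit D)\<rparr>"

definition unit_coalg :: "('o, 'a, 'z) smcat_scheme \<Rightarrow> ('o, 'a) coalg" where
  "unit_coalg V = \<lparr>Carr = \<one>\<^bsub>V\<^esub>, Comult = inv_arr V (Lunit V \<one>\<^bsub>V\<^esub>), Counit = Id V \<one>\<^bsub>V\<^esub>\<rparr>"

record ('o, 'a) bialg = "('o, 'a) coalg" +
  Mult :: "'a"
  Uni :: "'a"

definition is_bialg :: "('o, 'a, 'z) smcat_scheme \<Rightarrow> ('o, 'a) bialg \<Rightarrow> bool" where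
  "is_bialg V B \<longleftrightarrow> (let b = Carr B; m = Mult B; u = Uni B in
     is_coalg V B \<and> m \<in> hom V (b \<otimes>\<^bsub>V\<^esub> b) b \<and> u \<in> hom V \<one>\<^bsub>V\<^esub> b \<and>
     m \<cdot>\<^bsub>V\<^esub> (m \<odot>\<^bsub>V\<^esub> Id V b) = m \<cdot>\<^bsub>V\<^esub> (Id V b \<odot>\<^bsub>V\<^esub> m) \<cdot>\<^bsub>V\<^esub> Assoc V b b b \<and>
     m \<cdot>\<^bsub>V\<^esub> (u \<odot>\<^bsub>V\<^esub> Id V b) = Lunit V b \<and>
     m \<cdot>\<^bsub>V\<^esub> (Id V b \<odot>\<^bsub>V\<^esub> u) = Runit V b \<and>
     is_coalg_hom V (tensor_coalg V B B) B m \<and>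
     is_coalg_hom V (unit_coalg V) B u)"

definition is_bialg_hom ::
    "('o, 'a, 'z) smcat_scheme \<Rightarrow> ('o, 'a) bialg \<Rightarrow> ('o, 'a) bialg \<Rightarrow> 'a \<Rightarrow> bool" where
  "is_bialg_hom V B D f \<longleftrightarrow> is_coalg_hom V B D f \<and>
     f \<cdot>\<^bsub>V\<^esub> Mult B = Mult D \<cdot>\<^bsub>V\<^esub> (f \<odot>\<^bsub>V\<^esub> f) \<and> f \<cdot>\<^bsub>V\<^esub> Uni B = Uni D"

definition Bialg ::
    "('o, 'a, 'z) smcat_scheme \<Rightarrow>
     (('o, 'a) bialg, ('o, 'a) bialg \<times> ('o, 'a) bialg \<times> 'a) cat" where
  "Bialg V = structured_cat V {B. is_bialg V B} Carr (is_bialg_hom V)"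

definition is_antipode :: "('o, 'a, 'z) smcat_scheme \<Rightarrow> ('o, 'a) bialg \<Rightarrow> 'a \<Rightarrow> bool" where
  "is_antipode V B S \<longleftrightarrow> S \<in> hom V (Carr B) (Carr B) \<and>
     Mult B \<cdot>\<^bsub>V\<^esub> (S \<odot>\<^bsub>V\<^esub> Id V (Carr B)) \<cdot>\<^bsub>V\<^esub> Comult B = Uni B \<cdot>\<^bsub>V\<^esub> Counit B \<and>
     Mult B \<cdot>\<^bsub>V\<^esub> (Id V (Carr B) \<odot>\<^bsub>V\<^esub> S) \<cdot>\<^bsub>V\<^esub> Comult B = Uni B \<cdot>\<^bsub>V\<^esub> Counit B"

text \<open>
  Antipodes are unique and preserved by bialgebra morphisms, so Hopf algebras are taken as the full
  subcategory of the bialgebras that admit an antipode.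
\<close>

definition Hopf ::
    "('o, 'a, 'z) smcat_scheme \<Rightarrow>
     (('o, 'a) bialg, ('o, 'a) bialg \<times> ('o, 'a) bialg \<times> 'a) cat" where
  "Hopf V = structured_cat V {B. is_bialg V B \<and> (\<exists>S. is_antipode V B S)} Carr (is_bialg_hom V)"


section \<open>Enriched categories\<close>

text \<open>
  \<open>EComp E a b c : hom(b, c) \<otimes> hom(a, b) \<rightarrow> hom(a, c)\<close> and \<open>EId E a : \<one> \<rightarrow> hom(a, a)\<close>.
\<close>

record ('c, 'o, 'a) ecat =
  EObj :: "'c set"
  EHom :: "'c \<Rightarrow> 'c \<Rightarrow> 'o"
  EComp :: "'c \<Rightarrow> 'c \<Rightarrow> 'c \<Rightarrow> 'a"
  EId :: "'c \<Rightarrow> 'a"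

locale enriched_category =
  fixes V :: "('o, 'a, 'z) smcat_scheme" (structure)
    and E :: "('c, 'o, 'a, 'y) ecat_scheme"
  assumes ehom_obj: "a \<in> EObj E \<Longrightarrow> b \<in> EObj E \<Longrightarrow> EHom E a b \<in> Obj V"
    and ecomp_hom: "a \<in> EObj E \<Longrightarrow> b \<in> EObj E \<Longrightarrow> c \<in> EObj E \<Longrightarrow>
      EComp E a b c \<in> hom V (EHom E b c \<otimes> EHom E a b) (EHom E a c)"
    and eid_hom: "a \<in> EObj E \<Longrightarrow> EId E a \<in> hom V \<one> (EHom E a a)"
    and ecomp_assoc: "a \<in> EObj E \<Longrightarrow> b \<in> EObj E \<Longrightarrow> c \<in> EObj E \<Longrightarrow> d \<in> EObj E \<Longrightarrow>
      EComp E a b d \<cdot> (EComp E b c d \<odot> Id V (EHom E a b))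
        = EComp E a c d \<cdot> (Id V (EHom E c d) \<odot> EComp E a b c)
            \<cdot> Assoc V (EHom E c d) (EHom E b c) (EHom E a b)"
    and ecomp_eid: "a \<in> EObj E \<Longrightarrow> b \<in> EObj E \<Longrightarrow>
      EComp E a a b \<cdot> (Id V (EHom E a b) \<odot> EId E a) = Runit V (EHom E a b)"
    and eid_ecomp: "a \<in> EObj E \<Longrightarrow> b \<in> EObj E \<Longrightarrow>
      EComp E a b b \<cdot> (EId E b \<odot> Id V (EHom E a b)) = Lunit V (EHom E a b)"

text \<open>
  The underlying ordinary category, with arrows \<open>a \<rightarrow> b\<close> the arrows \<open>\<one> \<rightarrow> hom(a, b)\<close> of \<open>V\<close>, and
  the functor \<open>hom(c, -)\<close> from it to \<open>V\<close>.
\<close>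

definition underlying ::
    "('o, 'a, 'z) smcat_scheme \<Rightarrow> ('c, 'o, 'a, 'y) ecat_scheme \<Rightarrow> ('c, 'c \<times> 'c \<times> 'a) cat" where
  "underlying V E =
     \<lparr>Obj = EObj E,
      Arr = {(a, b, f). a \<in> EObj E \<and> b \<in> EObj E \<and> f \<in> hom V \<one>\<^bsub>V\<^esub> (EHom E a b)},
      Dom = (\<lambda>(a, b, f). a), Cod = (\<lambda>(a, b, f). b),
      Id = (\<lambda>a. (a, a, EId E a)),
      Comp = (\<lambda>(b, c, g) (a, b', f).
        (a, c, EComp E a b c \<cdot>\<^bsub>V\<^esub> (g \<odot>\<^bsub>V\<^esub> f) \<cdot>\<^bsub>V\<^esub> inv_arr V (Lunit V \<one>\<^bsub>V\<^esub>)))\<rparr>"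

definition ehom_func ::
    "('o, 'a, 'z) smcat_scheme \<Rightarrow> ('c, 'o, 'a, 'y) ecat_scheme \<Rightarrow> 'c \<Rightarrow>
     ('c, 'c \<times> 'c \<times> 'a, 'o, 'a) func" where
  "ehom_func V E c =
     \<lparr>OMap = EHom E c,
      AMap = (\<lambda>(d, e, f). EComp E c d e \<cdot>\<^bsub>V\<^esub> (f \<odot>\<^bsub>V\<^esub> Id V (EHom E c d)) \<cdot>\<^bsub>V\<^esub>
        inv_arr V (Lunit V (EHom E c d)))\<rparr>"

definition tensored :: "('o, 'a, 'z) smcat_scheme \<Rightarrow> ('c, 'o, 'a, 'y) ecat_scheme \<Rightarrow> bool" where
  "tensored V E \<longleftrightarrow> (\<forall>c \<in> EObj E. has_left_adjoint (underlying V E) V (ehom_func V E c))"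


section \<open>Multispans and measuring coalgebras\<close>

record ('o, 'a) span =
  LShape :: nat
  RShape :: nat
  Target :: "'o"
  LLeg :: "'a"
  RLeg :: "'a"

definition is_span ::
    "('o, 'a, 'z) smcat_scheme \<Rightarrow> ('c, 'o, 'a, 'y) ecat_scheme \<Rightarrow> 'c \<Rightarrow> 'c \<Rightarrow>
     ('o, 'a) span \<Rightarrow> bool" where
  "is_span V E A B s \<longleftrightarrow> Target s \<in> Obj V \<and>
     LLeg s \<in> hom V (tpow V (LShape s) (EHom E A B)) (Target s) \<and>
     RLeg s \<in> hom V (tpow V (RShape s) (EHom E A B)) (Target s)"

text \<open>A multispan is a family of spans indexed by a small set \<open>I\<close>; finite tuples are included.\<close>

definition is_multispan ::
    "'u itself \<Rightarrow> ('o, 'a, 'z) smcat_scheme \<Rightarrow> ('c, 'o, 'a, 'y) ecat_scheme \<Rightarrow> 'c \<Rightarrow> 'c \<Rightarrow>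
     'i set \<Rightarrow> ('i \<Rightarrow> ('o, 'a) span) \<Rightarrow> bool" where
  "is_multispan U V E A B I M \<longleftrightarrow> small U I \<and> (\<forall>i \<in> I. is_span V E A B (M i))"

definition measures ::
    "('o, 'a, 'z) smcat_scheme \<Rightarrow> ('c, 'o, 'a, 'y) ecat_scheme \<Rightarrow> 'c \<Rightarrow> 'c \<Rightarrow>
     'i set \<Rightarrow> ('i \<Rightarrow> ('o, 'a) span) \<Rightarrow> ('o, 'a) coalg \<Rightarrow> 'a \<Rightarrow> bool" where
  "measures V E A B I M C \<psi> \<longleftrightarrow> is_coalg V C \<and> \<psi> \<in> hom V (Carr C) (EHom E A B) \<and>
     (\<forall>i \<in> I. let l = LShape (M i); r = RShape (M i) in
        LLeg (M i) \<cdot>\<^bsub>V\<^esub> tpow_arr V l \<psi> \<cdot>\<^bsub>V\<^esub> iter_comult V C l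
          = RLeg (M i) \<cdot>\<^bsub>V\<^esub> tpow_arr V r \<psi> \<cdot>\<^bsub>V\<^esub> iter_comult V C r)"

definition measuring_cat ::
    "('o, 'a, 'z) smcat_scheme \<Rightarrow> ('c, 'o, 'a, 'y) ecat_scheme \<Rightarrow> 'c \<Rightarrow> 'c \<Rightarrow>
     'i set \<Rightarrow> ('i \<Rightarrow> ('o, 'a) span) \<Rightarrow>
     (('o, 'a) coalg \<times> 'a, (('o, 'a) coalg \<times> 'a) \<times> (('o, 'a) coalg \<times> 'a) \<times> 'a) cat" where
  "measuring_cat V E A B I M =
     structured_cat V {(C, \<psi>). measures V E A B I M C \<psi>} (\<lambda>(C, \<psi>). Carr C)
       (\<lambda>(C, \<psi>) (C', \<psi>') f. is_coalg_hom V C C' f \<and> \<psi>' \<cdot>\<^bsub>V\<^esub> f = \<psi>)"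

end

theory Submission
  imports Defs
begin

text \<open>
  Write \<open>H = hom(A, B)\<close>.  The right adjoint of the forgetful functor sends \<open>H\<close> to the cofree
  coalgebra \<open>\<epsilon> : K \<rightarrow> H\<close>, so a morphism \<open>\<psi> : C \<rightarrow> H\<close> out of a coalgebra is the same thing as a
  coalgebra morphism \<open>h : C \<rightarrow> K\<close>, with \<open>\<psi> = \<epsilon> h\<close> (\<open>cofree_coalgebra\<close>).  Coalgebra morphisms
  commute with iterated comultiplications, so each side of the measuring equation for \<open>\<epsilon> h\<close> is the
  same side for \<open>\<epsilon>\<close> precomposed with \<open>h\<close> (\<open>leg_comp_coalg_hom\<close>): there are fixed morphisms
  \<open>a\<^sub>i, b\<^sub>i : K \<rightarrow> T\<^sub>i\<close> such that \<open>\<epsilon> h\<close> measures if and only if \<open>a\<^sub>i h = b\<^sub>i h\<close> for all \<open>i\<close>.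

  The \<open>T\<^sub>i\<close> are mere objects, but the \<open>a\<^sub>i\<close> and \<open>b\<^sub>i\<close> correspond to coalgebra morphisms
  \<open>S\<^sub>i, R\<^sub>i\<close> from \<open>K\<close> to the cofree coalgebra on \<open>T\<^sub>i\<close>, and by uniqueness of such lifts the condition
  becomes \<open>S\<^sub>i h = R\<^sub>i h\<close>.  Hence measuring coalgebras are coalgebras over \<open>K\<close> whose structure
  morphism equalizes all the pairs \<open>(S\<^sub>i, R\<^sub>i)\<close>, and the terminal one is the joint equalizer of these
  pairs among coalgebras, a limit of small shape (\<open>complete_has_joint_equalizers\<close>).
\<close>

section \<open>Universal arrows and small limits\<close>

lemma hom_memD:
  assumes "category C" and "f \<in> hom C a b"
  shows "a \<in> Obj C" and "b \<in> Obj C" and "f \<in> Arr C" and "Dom C f = a" and "Cod C f = b"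
  using assms category.dom_obj[of C f] category.cod_obj[of C f] by (auto simp: hom_def)

text \<open>
  The counit of the adjunction at \<open>d\<close>: it is the arrow that the hom-set bijection takes to the
  identity, and naturality shows that \<open>h \<mapsto> \<epsilon> \<cdot> F h\<close> inverts that bijection.
\<close>

lemma adjunction_universal_arrow:
  assumes adj: "adjunction C D F G" and d: "d \<in> Obj D"
  obtains \<epsilon> where "OMap G d \<in> Obj C" and "\<epsilon> \<in> hom D (OMap F (OMap G d)) d"
    and "\<And>c f. c \<in> Obj C \<Longrightarrow> f \<in> hom D (OMap F c) d \<Longrightarrow>
      \<exists>!h. h \<in> hom C c (OMap G d) \<and> Comp D \<epsilon> (AMap F h) = f"
proof -
  obtain \<phi> where F: "is_functor C D F" and G: "is_functor D C G"
    and bij: "\<And>c d. c \<in> Obj C \<Longrightarrow> d \<in> Obj D \<Longrightarrow>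
      bij_betw (\<phi> c d) (hom D (OMap F c) d) (hom C c (OMap G d))"
    and nat: "\<And>c c' d d' u v f. c \<in> Obj C \<Longrightarrow> c' \<in> Obj C \<Longrightarrow> d \<in> Obj D \<Longrightarrow> d' \<in> Obj D \<Longrightarrow>
      u \<in> hom C c' c \<Longrightarrow> v \<in> hom D d d' \<Longrightarrow> f \<in> hom D (OMap F c) d \<Longrightarrow>
      \<phi> c' d' (Comp D v (Comp D f (AMap F u))) = Comp C (AMap G v) (Comp C (\<phi> c d f) u)"
    using adj unfolding adjunction_def by blast
  interpret C: category C using F by (simp add: is_functor_def)
  interpret D: category D using F by (simp add: is_functor_def)
  let ?K = "OMap G d"
  have K: "?K \<in> Obj C" and GId: "AMap G (Id D d) = Id C ?K"
    using G d by (auto simp: is_functor_def)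
  have "Id C ?K \<in> \<phi> ?K d ` hom D (OMap F ?K) d"
    using bij[OF K d] C.id_hom[OF K] by (simp add: bij_betw_def)
  then obtain \<epsilon> where \<epsilon>: "\<epsilon> \<in> hom D (OMap F ?K) d" and \<phi>\<epsilon>: "\<phi> ?K d \<epsilon> = Id C ?K"
    by force
  have comp: "Comp D \<epsilon> (AMap F h) \<in> hom D (OMap F c) d" if h: "h \<in> hom C c ?K" for c h
  proof -
    have "AMap F h \<in> hom D (OMap F c) (OMap F ?K)"
      using F h by (auto simp: is_functor_def hom_def)
    then show ?thesis using \<epsilon> by (rule D.comp_hom)
  qed
  have inv: "\<phi> c d (Comp D \<epsilon> (AMap F h)) = h" if c: "c \<in> Obj C" and h: "h \<in> hom C c ?K" for c h
    using nat[OF K c d d h D.id_hom[OF d] \<epsilon>]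
    by (simp add: D.id_comp[OF comp[OF h]] GId \<phi>\<epsilon> C.id_comp[OF h])
  have "\<exists>!h. h \<in> hom C c ?K \<and> Comp D \<epsilon> (AMap F h) = f"
    if c: "c \<in> Obj C" and f: "f \<in> hom D (OMap F c) d" for c f
  proof -
    have h: "\<phi> c d f \<in> hom C c ?K" using bij[OF c d] f by (auto simp: bij_betw_def)
    have "Comp D \<epsilon> (AMap F (\<phi> c d f)) = f"
      by (rule inj_onD[OF bij_betw_imp_inj_on[OF bij[OF c d]] inv[OF c h] comp[OF h] f])
    then show ?thesis
      using h inv[OF c] by (intro ex1I[of _ "\<phi> c d f"]) auto
  qed
  with K \<epsilon> show thesis by (rule that)
qed

text \<open>
  Completeness speaks of shapes whose objects and arrows are elements of the size type \<open>'u\<close>.  An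
  injection of the arrows of \<open>J\<close> into \<open>'u\<close> carries the structure of \<open>J\<close> over to an isomorphic
  shape \<open>J'\<close> of this kind, and limits over \<open>J'\<close> are limits over \<open>J\<close>.
\<close>

lemma complete_has_small_limits:
  fixes C :: "('o, 'a, 'z) cat_scheme" and J :: "('j, 'k) cat"
  assumes complete: "complete TYPE('u) C" and small: "small TYPE('u) (Arr J)"
    and D_functor: "is_functor J C D"
  shows "\<exists>x p. is_limit J C D x p"
proof -
  interpret J: category J using D_functor by (simp add: is_functor_def)
  obtain g :: "'k \<Rightarrow> 'u" where g: "inj_on g (Arr J)"
    using small unfolding small_def by (metis card_of_ordLeq ordLess_imp_ordLeq)
  define k where "k = inv_into (Arr J) g"
  \<comment> \<open>An object has the same code as its identity, so objects of \<open>J'\<close> are their own identities.\<close>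
  define e where "e = g \<circ> Id J"
  have k: "k (g u) = u" if "u \<in> Arr J" for u
    unfolding k_def using g that by (rule inv_into_f_f)
  have idA: "Id J a \<in> Arr J" "Dom J (Id J a) = a" "Cod J (Id J a) = a" if "a \<in> Obj J" for a
    using J.id_hom[OF that] by (auto simp: hom_def)
  have ke: "k (e a) = Id J a" if "a \<in> Obj J" for a
    using that by (simp add: e_def k idA)
  have e_inj: "e a = e b \<longleftrightarrow> a = b" if "a \<in> Obj J" "b \<in> Obj J" for a b
    using that ke idA by metis
  define J' :: "('u, 'u) cat" where "J' = \<lparr>Obj = e ` Obj J, Arr = g ` Arr J,
    Dom = (\<lambda>u. e (Dom J (k u))), Cod = (\<lambda>u. e (Cod J (k u))), Id = (\<lambda>x. x),
    Comp = (\<lambda>v u. g (Comp J (k v) (k u)))\<rparr>"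
  define D' :: "('u, 'u, 'o, 'a) func" where
    "D' = \<lparr>OMap = (\<lambda>x. OMap D (Dom J (k x))), AMap = (\<lambda>u. AMap D (k u))\<rparr>"
  have J'_simps: "Obj J' = e ` Obj J" "Arr J' = g ` Arr J" "Id J' x = x"
    "Dom J' u = e (Dom J (k u))" "Cod J' u = e (Cod J (k u))"
    "Comp J' v u = g (Comp J (k v) (k u))" for x u v
    by (simp_all add: J'_def)
  have D'_simps: "OMap D' x = OMap D (Dom J (k x))" "AMap D' u = AMap D (k u)" for x u
    by (simp_all add: D'_def)
  have hom': "hom J' x y = g ` {u \<in> Arr J. e (Dom J u) = x \<and> e (Cod J u) = y}" for x y
    by (auto simp: hom_def J'_simps k)
  have hom'E: "\<exists>u a b. f = g u \<and> u \<in> hom J a b \<and> x = e a \<and> y = e b \<and> k f = u"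
    if "f \<in> hom J' x y" for f x y
    using that unfolding hom' by (auto simp: k hom_def)
  have catJ': "category J'"
  proof
    fix f assume "f \<in> Arr J'"
    then show "Dom J' f \<in> Obj J'" "Cod J' f \<in> Obj J'"
      by (auto simp: J'_simps k J.dom_obj J.cod_obj)
  next
    fix a assume "a \<in> Obj J'"
    then show "Id J' a \<in> hom J' a a"
      by (auto simp: J'_simps hom' idA e_def)
  next
    fix f a b h c assume f: "f \<in> hom J' a b" and h: "h \<in> hom J' b c"
    obtain f' a' b' where f': "f' \<in> hom J a' b'" "a = e a'" "b = e b'" "k f = f'"
      using hom'E[OF f] by blast
    obtain h' b'' c' where h': "h' \<in> hom J b'' c'" "b = e b''" "c = e c'" "k h = h'"
      using hom'E[OF h] by blast
    have "b'' = b'"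
      using e_inj[of b'' b'] hom_memD[OF J.category_axioms f'(1)] hom_memD[OF J.category_axioms h'(1)]
        f'(3) h'(2) by simp
    then have "Comp J h' f' \<in> hom J a' c'" using J.comp_hom[OF f'(1)] h'(1) by simp
    then show "Comp J' h f \<in> hom J' a c"
      using f' h' unfolding hom' by (auto simp: J'_simps hom_def)
  next
    fix f a b assume "f \<in> hom J' a b"
    then show "Comp J' f (Id J' a) = f" "Comp J' (Id J' b) f = f"
      using hom'E[of f a b] hom_memD[OF J.category_axioms]
      by (auto simp: J'_simps ke J.comp_id J.id_comp)
  next
    fix f a b h c m d assume f: "f \<in> hom J' a b" and h: "h \<in> hom J' b c" and m: "m \<in> hom J' c d"
    obtain f' a' b' where f': "f' \<in> hom J a' b'" "b = e b'" "k f = f'" using hom'E[OF f] by blast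
    obtain h' b'' c' where h': "h' \<in> hom J b'' c'" "b = e b''" "c = e c'" "k h = h'"
      using hom'E[OF h] by blast
    obtain m' c'' d' where m': "m' \<in> hom J c'' d'" "c = e c''" "k m = m'" using hom'E[OF m] by blast
    have eq: "b'' = b'" "c'' = c'"
      using e_inj[of b'' b'] e_inj[of c'' c'] f' h' m' hom_memD[OF J.category_axioms f'(1)]
        hom_memD[OF J.category_axioms h'(1)] hom_memD[OF J.category_axioms m'(1)] by simp_all
    have "Comp J h' f' \<in> Arr J" "Comp J m' h' \<in> Arr J"
      using J.comp_hom[of f' a' b' h' c'] J.comp_hom[of h' b' c' m' d'] f' h' m' eq
      by (auto simp: hom_def)
    then show "Comp J' (Comp J' m h) f = Comp J' m (Comp J' h f)"
      using J.comp_assoc[of f' a' b' h' c' m' d'] f' h' m' eq by (simp add: J'_simps k)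
  qed
  have "|g ` Arr J| \<le>o |Arr J|" by (rule card_of_image)
  then have "small_cat J'"
    using catJ' small ordLeq_ordLess_trans by (auto simp: small_cat_def small_def J'_simps)
  moreover have "is_functor J' C D'"
    unfolding is_functor_def
  proof (intro conjI ballI impI)
    show "category J'" by (rule catJ')
    show "category C" using D_functor by (simp add: is_functor_def)
  next
    fix a assume "a \<in> Obj J'"
    then show "OMap D' a \<in> Obj C" "AMap D' (Id J' a) = Id C (OMap D' a)"
      using D_functor by (auto simp: J'_simps D'_simps ke idA is_functor_def)
  next
    fix f assume "f \<in> Arr J'"
    then show "AMap D' f \<in> hom C (OMap D' (Dom J' f)) (OMap D' (Cod J' f))"
      using D_functor
      by (auto simp: J'_simps D'_simps k ke idA J.dom_obj J.cod_obj is_functor_def)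
  next
    fix u v assume "u \<in> Arr J'" "v \<in> Arr J'" and m: "Cod J' u = Dom J' v"
    then obtain u' v' where u': "u = g u'" "u' \<in> Arr J" and v': "v = g v'" "v' \<in> Arr J"
      by (auto simp: J'_simps)
    have m': "Cod J u' = Dom J v'"
      using m u' v' by (simp add: J'_simps k e_inj J.dom_obj J.cod_obj)
    have "Comp J v' u' \<in> Arr J"
      using J.comp_hom[of u' "Dom J u'" "Cod J u'" v' "Cod J v'"] u' v' m' by (auto simp: hom_def)
    then show "AMap D' (Comp J' v u) = Comp C (AMap D' v) (AMap D' u)"
      using D_functor u' v' m' by (simp add: J'_simps D'_simps k is_functor_def)
  qed
  ultimately obtain x p' where lim: "is_limit J' C D' x p'"
    using complete unfolding complete_def by blast
  \<comment> \<open>Every cone over \<open>J\<close> is of the form on the left, up to the values of the legs off \<open>Obj J\<close>.\<close>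
  have cone: "is_cone J C D y (\<lambda>j. q (e j)) \<longleftrightarrow> is_cone J' C D' y q" for y q
    by (auto simp: is_cone_def J'_simps D'_simps k ke idA)
  have cong: "is_cone J C D y q \<longleftrightarrow> is_cone J C D y q'" if "\<And>j. j \<in> Obj J \<Longrightarrow> q j = q' j" for y q q'
    using that J.dom_obj J.cod_obj by (auto simp: is_cone_def)
  have "is_limit J C D x (\<lambda>j. p' (e j))"
    unfolding is_limit_def
  proof (intro conjI allI impI)
    show "is_cone J C D x (\<lambda>j. p' (e j))" using lim by (simp add: cone is_limit_def)
  next
    fix y q assume q: "is_cone J C D y q"
    define q' where "q' = (\<lambda>x. q (Dom J (k x)))"
    have q': "q' (e j) = q j" if "j \<in> Obj J" for j using that by (simp add: q'_def ke idA)
    have "is_cone J' C D' y q'" using q q' cong[of "\<lambda>j. q' (e j)" q] cone[of y q'] by simp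
    then have "\<exists>!h. h \<in> hom C y x \<and> (\<forall>j \<in> Obj J'. Comp C (p' j) h = q' j)"
      using lim by (simp add: is_limit_def)
    then show "\<exists>!h. h \<in> hom C y x \<and> (\<forall>j \<in> Obj J. Comp C (p' (e j)) h = q j)"
      by (simp add: J'_simps q' cong: ball_cong)
  qed
  then show ?thesis by blast
qed

text \<open>
  The shape of a family of parallel pairs with a common source: \<open>None\<close> is the source, \<open>Some i\<close> is the
  target of the \<open>i\<close>-th pair, and the truth value tells the two arrows of a pair apart.  No two
  non-identity arrows are composable.
\<close>

definition pairs_shape :: "'i set \<Rightarrow> ('i option, 'i option \<times> 'i option \<times> bool) cat" where
  "pairs_shape I = \<lparr>Obj = insert None (Some ` I),
     Arr = {(x, y, b). x \<in> insert None (Some ` I) \<and> y \<in> insert None (Some ` I) \<and>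
       (x = y \<and> \<not> b \<or> x = None \<and> y \<noteq> None)},
     Dom = (\<lambda>(x, y, b). x), Cod = (\<lambda>(x, y, b). y), Id = (\<lambda>x. (x, x, False)),
     Comp = (\<lambda>v u. if fst u = fst (snd u) then v else u)\<rparr>"

lemma pairs_shape_category: "category (pairs_shape I)"
  by unfold_locales (auto simp: pairs_shape_def hom_def split: if_splits)

text \<open>
  The arrows are covered by three copies of \<open>I\<close> and one point, and a finite union of sets smaller
  than an infinite set is again smaller.
\<close>

lemma small_pairs_shape:
  fixes I :: "'i set"
  assumes "infinite (UNIV :: 'u set)" and I: "small TYPE('u) I"
  shows "small TYPE('u) (Arr (pairs_shape I))"
proof -
  have inf: "\<not> finite (UNIV :: 'u set)" by fact
  have img: "|f ` I| <o |UNIV :: 'u set|" for f :: "'i \<Rightarrow> 'i option \<times> 'i option \<times> bool"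
    using I card_of_image ordLeq_ordLess_trans unfolding small_def by blast
  have one: "|{(None, None, False)} :: ('i option \<times> 'i option \<times> bool) set| <o |UNIV :: 'u set|"
    using inf by (auto intro!: finite_ordLess_infinite simp: Field_card_of card_of_well_order_on)
  have "Arr (pairs_shape I) = {(None, None, False)} \<union>
      ((\<lambda>i. (Some i, Some i, False)) ` I \<union>
        ((\<lambda>i. (None, Some i, False)) ` I \<union> (\<lambda>i. (None, Some i, True)) ` I))"
    by (auto simp: pairs_shape_def image_iff)
  then show ?thesis
    unfolding small_def
    by (simp only:) (intro card_of_Un_ordLess_infinite[OF inf] img one)
qed

text \<open>
  The leg of a cone at the target of a pair is determined by the leg at the source, so a cone over a
  family of parallel pairs is just an arrow into the source that equalizes every pair.
\<close>

lemma complete_has_joint_equalizers: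
  fixes C :: "('o, 'a, 'z) cat_scheme"
  assumes complete: "complete TYPE('u) C" and inf: "infinite (UNIV :: 'u set)"
    and small: "small TYPE('u) I" and x: "x \<in> Obj C"
    and S: "\<And>i. i \<in> I \<Longrightarrow> S i \<in> hom C x (y i)" and R: "\<And>i. i \<in> I \<Longrightarrow> R i \<in> hom C x (y i)"
  obtains w p where "p \<in> hom C w x" and "\<And>i. i \<in> I \<Longrightarrow> Comp C (S i) p = Comp C (R i) p"
    and "\<And>z h. h \<in> hom C z x \<Longrightarrow> (\<And>i. i \<in> I \<Longrightarrow> Comp C (S i) h = Comp C (R i) h) \<Longrightarrow>
      \<exists>!g. g \<in> hom C z w \<and> Comp C p g = h"
proof -
  interpret C: category C using complete by (simp add: complete_def)
  let ?J = "pairs_shape I"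
  define D where "D = \<lparr>OMap = case_option x y, AMap = (\<lambda>(u, v, b). case v of None \<Rightarrow> Id C x |
    Some i \<Rightarrow> if u = v then Id C (y i) else if b then R i else S i)\<rparr>"
  have y: "y i \<in> Obj C" if "i \<in> I" for i
    using hom_memD(2)[OF C.category_axioms S[OF that]] .
  have J: "Obj ?J = insert None (Some ` I)" by (simp add: pairs_shape_def)
  have ball_Arr: "(\<forall>u \<in> Arr ?J. P u) \<longleftrightarrow> P (None, None, False) \<and>
      (\<forall>i \<in> I. P (Some i, Some i, False) \<and> P (None, Some i, False) \<and> P (None, Some i, True))" for P
  proof -
    have "Arr ?J = insert (None, None, False) (\<Union>i \<in> I.
        {(Some i, Some i, False), (None, Some i, False), (None, Some i, True)})"
      by (auto simp: pairs_shape_def)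
    then show ?thesis by auto
  qed
  have J_simps: "Dom ?J (u, v, b) = u" "Cod ?J (u, v, b) = v" "Id ?J u = (u, u, False)"
    "Comp ?J (v, w, c) (u, v, b) = (if u = v then (v, w, c) else (u, v, b))" for u v w b c
    by (simp_all add: pairs_shape_def)
  have D_simps: "OMap D None = x" "OMap D (Some i) = y i" "AMap D (None, None, False) = Id C x"
    "AMap D (Some i, Some i, False) = Id C (y i)" "AMap D (None, Some i, False) = S i"
    "AMap D (None, Some i, True) = R i" for i
    by (simp_all add: D_def)
  have cone: "is_cone ?J C D z q \<longleftrightarrow> z \<in> Obj C \<and> q None \<in> hom C z x \<and>
      (\<forall>i \<in> I. q (Some i) \<in> hom C z (y i) \<and> Comp C (S i) (q None) = q (Some i) \<and>
        Comp C (R i) (q None) = q (Some i))" for z q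
    unfolding is_cone_def ball_Arr J by (auto simp: J_simps D_simps C.id_comp)
  have "is_functor ?J C D"
    unfolding is_functor_def
  proof (intro conjI)
    show "category ?J" by (rule pairs_shape_category)
    show "category C" by (rule C.category_axioms)
    show "\<forall>a \<in> Obj ?J. OMap D a \<in> Obj C" using x y by (auto simp: J D_simps)
    show "\<forall>u \<in> Arr ?J. AMap D u \<in> hom C (OMap D (Dom ?J u)) (OMap D (Cod ?J u))"
      unfolding ball_Arr using x y S R by (auto simp: J_simps D_simps C.id_hom)
    show "\<forall>a \<in> Obj ?J. AMap D (Id ?J a) = Id C (OMap D a)"
      by (auto simp: J J_simps D_simps)
    show "\<forall>u \<in> Arr ?J. \<forall>v \<in> Arr ?J. Cod ?J u = Dom ?J v \<longrightarrow>
        AMap D (Comp ?J v u) = Comp C (AMap D v) (AMap D u)"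
      unfolding ball_Arr using C.id_comp[OF S] C.id_comp[OF R] C.comp_id[OF S] C.comp_id[OF R]
        C.id_comp[OF C.id_hom[OF x]] C.id_comp[OF C.id_hom[OF y]]
      by (simp add: J_simps D_simps)
  qed
  then obtain w p where lim: "is_limit ?J C D w p"
    using complete_has_small_limits[OF complete small_pairs_shape[OF inf small]] by blast
  show thesis
  proof
    show p: "p None \<in> hom C w x" and "\<And>i. i \<in> I \<Longrightarrow> Comp C (S i) (p None) = Comp C (R i) (p None)"
      using lim by (auto simp: is_limit_def cone)
    have pS: "Comp C (S i) (p None) = p (Some i)" if "i \<in> I" for i
      using lim that by (auto simp: is_limit_def cone)
    fix z h assume h: "h \<in> hom C z x" and eq: "\<And>i. i \<in> I \<Longrightarrow> Comp C (S i) h = Comp C (R i) h"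
    define q where "q = case_option h (\<lambda>i. Comp C (S i) h)"
    have "is_cone ?J C D z q"
      using h eq C.comp_hom[OF h S] hom_memD(1)[OF C.category_axioms h] by (auto simp: cone q_def)
    then have ex: "\<exists>!g. g \<in> hom C z w \<and> (\<forall>j \<in> Obj ?J. Comp C (p j) g = q j)"
      using lim by (simp add: is_limit_def)
    have "(\<forall>j \<in> Obj ?J. Comp C (p j) g = q j) \<longleftrightarrow> Comp C (p None) g = h" if g: "g \<in> hom C z w" for g
      using C.comp_assoc[OF g p S] pS by (auto simp: J q_def)
    then show "\<exists>!g. g \<in> hom C z w \<and> Comp C (p None) g = h"
      using ex by (metis (no_types, lifting))
  qed
qed

section \<open>Iterated comultiplications\<close>

context symmetric_monoidal
begin

lemma tpow_arr_hom: "f \<in> hom V a b \<Longrightarrow> tpow_arr V n f \<in> hom V (tpow V n a) (tpow V n b)"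
  by (induction n rule: induct_nat_012) (simp_all add: unit_obj id_hom tens_hom)

lemma tpow_arr_comp:
  "f \<in> hom V a b \<Longrightarrow> g \<in> hom V b c \<Longrightarrow>
    tpow_arr V n (g \<cdot> f) = tpow_arr V n g \<cdot> tpow_arr V n f"
proof (induction n rule: induct_nat_012)
  case 0
  then show ?case using comp_id[OF id_hom[OF unit_obj]] by simp
next
  case (ge2 n)
  then show ?case
    using tens_comp[OF ge2.prems tpow_arr_hom[OF ge2.prems(1)] tpow_arr_hom[OF ge2.prems(2)]]
    by simp
qed simp

lemma iter_comult_hom:
  assumes "is_coalg V C"
  shows "iter_comult V C n \<in> hom V (Carr C) (tpow V n (Carr C))"
proof -
  have C: "Carr C \<in> Obj V" "Comult C \<in> hom V (Carr C) (Carr C \<otimes> Carr C)"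
    "Counit C \<in> hom V (Carr C) \<one>"
    using assms by (simp_all add: is_coalg_def Let_def)
  show ?thesis
  proof (induction n rule: induct_nat_012)
    case (ge2 n)
    then show ?case using comp_hom[OF C(2) tens_hom[OF id_hom[OF C(1)]]] by simp
  qed (simp_all add: C id_hom)
qed

lemma iter_comult_natural:
  assumes C: "is_coalg V C" and D: "is_coalg V D" and f: "is_coalg_hom V C D f"
  shows "iter_comult V D n \<cdot> f = tpow_arr V n f \<cdot> iter_comult V C n"
proof -
  have c: "Carr C \<in> Obj V" "Comult C \<in> hom V (Carr C) (Carr C \<otimes> Carr C)"
    "Counit C \<in> hom V (Carr C) \<one>"
    using C by (simp_all add: is_coalg_def Let_def)
  have d: "Carr D \<in> Obj V" "Comult D \<in> hom V (Carr D) (Carr D \<otimes> Carr D)"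
    using D by (simp_all add: is_coalg_def Let_def)
  have f': "f \<in> hom V (Carr C) (Carr D)" "Comult D \<cdot> f = (f \<odot> f) \<cdot> Comult C"
    "Counit D \<cdot> f = Counit C"
    using f by (simp_all add: is_coalg_hom_def)
  show ?thesis
  proof (induction n rule: induct_nat_012)
    case 0
    then show ?case using f' id_comp[OF c(3)] by simp
  next
    case 1
    then show ?case using comp_id[OF f'(1)] id_comp[OF f'(1)] by simp
  next
    case (ge2 n)
    let ?m = "Suc n"
    let ?\<Delta>C = "iter_comult V C ?m" and ?\<Delta>D = "iter_comult V D ?m"
    note \<Delta>C = iter_comult_hom[OF C, of ?m] and \<Delta>D = iter_comult_hom[OF D, of ?m]
    have "(Id V (Carr D) \<odot> ?\<Delta>D) \<cdot> Comult D \<cdot> f = (Id V (Carr D) \<odot> ?\<Delta>D) \<cdot> (f \<odot> f) \<cdot> Comult C"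
      by (simp add: f')
    also have "\<dots> = ((Id V (Carr D) \<cdot> f) \<odot> (?\<Delta>D \<cdot> f)) \<cdot> Comult C"
      using comp_assoc[OF c(2) tens_hom[OF f'(1) f'(1)] tens_hom[OF id_hom[OF d(1)] \<Delta>D]]
        tens_comp[OF f'(1) id_hom[OF d(1)] f'(1) \<Delta>D] by simp
    also have "\<dots> = ((f \<cdot> Id V (Carr C)) \<odot> (tpow_arr V ?m f \<cdot> ?\<Delta>C)) \<cdot> Comult C"
      using comp_id[OF f'(1)] id_comp[OF f'(1)] ge2 by simp
    also have "\<dots> = (f \<odot> tpow_arr V ?m f) \<cdot> (Id V (Carr C) \<odot> ?\<Delta>C) \<cdot> Comult C"
      using comp_assoc[OF c(2) tens_hom[OF id_hom[OF c(1)] \<Delta>C]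
          tens_hom[OF f'(1) tpow_arr_hom[OF f'(1), of ?m]]]
        tens_comp[OF id_hom[OF c(1)] f'(1) \<Delta>C tpow_arr_hom[OF f'(1), of ?m]] by simp
    finally show ?case
      using comp_assoc[OF f'(1) d(2) tens_hom[OF id_hom[OF d(1)] \<Delta>D]] by simp
  qed
qed

lemma coalg_hom_comp:
  assumes C: "is_coalg V C" and D: "is_coalg V D" and K: "is_coalg V K"
    and f: "is_coalg_hom V C D f" and g: "is_coalg_hom V D K g"
  shows "is_coalg_hom V C K (g \<cdot> f)"
proof -
  have c: "Comult C \<in> hom V (Carr C) (Carr C \<otimes> Carr C)"
    and d: "Comult D \<in> hom V (Carr D) (Carr D \<otimes> Carr D)"
    and k: "Comult K \<in> hom V (Carr K) (Carr K \<otimes> Carr K)" "Counit K \<in> hom V (Carr K) \<one>"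
    using C D K by (simp_all add: is_coalg_def Let_def)
  have f': "f \<in> hom V (Carr C) (Carr D)" "Comult D \<cdot> f = (f \<odot> f) \<cdot> Comult C"
    "Counit D \<cdot> f = Counit C"
    and g': "g \<in> hom V (Carr D) (Carr K)" "Comult K \<cdot> g = (g \<odot> g) \<cdot> Comult D"
    "Counit K \<cdot> g = Counit D"
    using f g by (simp_all add: is_coalg_hom_def)
  note ff = tens_hom[OF f'(1) f'(1)] and gg = tens_hom[OF g'(1) g'(1)]
  have "Comult K \<cdot> g \<cdot> f = (g \<odot> g) \<cdot> Comult D \<cdot> f"
    using comp_assoc[OF f'(1) g'(1) k(1)] comp_assoc[OF f'(1) d gg] g'(2) by simp
  also have "\<dots> = ((g \<cdot> f) \<odot> (g \<cdot> f)) \<cdot> Comult C"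
    using comp_assoc[OF c ff gg] tens_comp[OF f'(1) g'(1) f'(1) g'(1)] f'(2) by simp
  finally have "Comult K \<cdot> g \<cdot> f = ((g \<cdot> f) \<odot> (g \<cdot> f)) \<cdot> Comult C" .
  moreover have "Counit K \<cdot> g \<cdot> f = Counit C"
    using comp_assoc[OF f'(1) g'(1) k(2)] f'(3) g'(3) by simp
  ultimately show ?thesis
    using comp_hom[OF f'(1) g'(1)] by (simp add: is_coalg_hom_def)
qed

text \<open>One side of the measuring equation for a span with leg \<open>s\<close> of shape \<open>n\<close>.\<close>

definition leg_comp :: "nat \<Rightarrow> 'a \<Rightarrow> ('o, 'a) coalg \<Rightarrow> 'a \<Rightarrow> 'a" where
  "leg_comp n s C \<psi> = s \<cdot> tpow_arr V n \<psi> \<cdot> iter_comult V C n"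

lemma leg_comp_hom:
  assumes "is_coalg V C" "\<psi> \<in> hom V (Carr C) H" "s \<in> hom V (tpow V n H) T"
  shows "leg_comp n s C \<psi> \<in> hom V (Carr C) T"
  unfolding leg_comp_def
  using assms by (blast intro: comp_hom iter_comult_hom tpow_arr_hom)

text \<open>
  This is what makes the measuring equations for \<open>\<psi> \<cdot> f\<close> a condition on \<open>f\<close> alone once \<open>\<psi>\<close> is fixed:
  \<open>f\<close> moves past the iterated comultiplication because it is a coalgebra morphism.
\<close>

lemma leg_comp_coalg_hom:
  assumes C: "is_coalg V C" and D: "is_coalg V D" and f: "is_coalg_hom V C D f"
    and \<psi>: "\<psi> \<in> hom V (Carr D) H" and s: "s \<in> hom V (tpow V n H) T"
  shows "leg_comp n s C (\<psi> \<cdot> f) = leg_comp n s D \<psi> \<cdot> f"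
proof -
  have f': "f \<in> hom V (Carr C) (Carr D)" using f by (simp add: is_coalg_hom_def)
  note \<Delta>C = iter_comult_hom[OF C, of n] and \<Delta>D = iter_comult_hom[OF D, of n]
    and fn = tpow_arr_hom[OF f', of n] and \<psi>n = tpow_arr_hom[OF \<psi>, of n]
  have "tpow_arr V n (\<psi> \<cdot> f) \<cdot> iter_comult V C n = tpow_arr V n \<psi> \<cdot> iter_comult V D n \<cdot> f"
    by (simp add: tpow_arr_comp[OF f' \<psi>] comp_assoc[OF \<Delta>C fn \<psi>n] iter_comult_natural[OF C D f])
  also have "\<dots> = (tpow_arr V n \<psi> \<cdot> iter_comult V D n) \<cdot> f"
    by (simp add: comp_assoc[OF f' \<Delta>D \<psi>n])
  finally show ?thesis
    by (simp add: leg_comp_def comp_assoc[OF f' comp_hom[OF \<Delta>D \<psi>n] s])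
qed

end

section \<open>Cofree coalgebras and the terminal measuring coalgebra\<close>

text \<open>
  Arrows of a category of structured objects are tagged with their domain and codomain.  This strips
  the tags from a universal property.
\<close>

lemma ex1_tagged:
  "(\<exists>!x. x \<in> (\<lambda>g. (c, d, g)) ` {g. P g} \<and> Q x) \<longleftrightarrow> (\<exists>!g. P g \<and> Q (c, d, g))"
  (is "(\<exists>!x. ?L x) \<longleftrightarrow> (\<exists>!g. ?R g)")
proof -
  have L: "?L x \<longleftrightarrow> (\<exists>g. x = (c, d, g) \<and> ?R g)" for x by auto
  show ?thesis
  proof
    assume "\<exists>!x. ?L x"
    then obtain x where x: "?L x" and unique: "\<And>y. ?L y \<Longrightarrow> y = x" by metis
    from x obtain g where g: "x = (c, d, g)" "?R g" unfolding L by blast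
    show "\<exists>!g. ?R g"
    proof (rule ex1I[of _ g])
      show "?R g" by (rule g)
      show "g' = g" if "?R g'" for g' using unique[of "(c, d, g')"] that g(1) by simp
    qed
  next
    assume "\<exists>!g. ?R g"
    then obtain g where g: "?R g" and unique: "\<And>g'. ?R g' \<Longrightarrow> g' = g" by metis
    show "\<exists>!x. ?L x"
    proof (rule ex1I[of _ "(c, d, g)"])
      show "?L (c, d, g)" using g by simp
      show "x = (c, d, g)" if "?L x" for x
      proof -
        from that obtain g' where "x = (c, d, g')" "?R g'" unfolding L by blast
        then show ?thesis using unique[of g'] by simp
      qed
    qed
  qed
qed

lemma hom_Coalg:
  "hom (Coalg V) C D = {(C, D, f) |f. is_coalg V C \<and> is_coalg V D \<and> is_coalg_hom V C D f}"
  by (auto simp: hom_def Coalg_def structured_cat_def is_coalg_hom_def)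

lemma ex1_hom_Coalg:
  assumes "is_coalg V C" and "is_coalg V D"
  shows "(\<exists>!h. h \<in> hom (Coalg V) C D \<and> Q h) \<longleftrightarrow> (\<exists>!f. is_coalg_hom V C D f \<and> Q (C, D, f))"
proof -
  have "hom (Coalg V) C D = (\<lambda>f. (C, D, f)) ` {f. is_coalg_hom V C D f}"
    using assms by (auto simp: hom_Coalg)
  then show ?thesis by (simp only: ex1_tagged)
qed

lemma Comp_Coalg: "Comp (Coalg V) (D, D', g) (C, C', f) = (C, D', Comp V g f)"
  by (simp add: Coalg_def structured_cat_def)

lemma cofree_coalgebra:
  fixes V :: "('o, 'a, 'z) smcat_scheme"
  assumes adj: "has_right_adjoint (Coalg V) V forget_coalg" and x: "x \<in> Obj V"
  obtains K :: "('o, 'a) coalg" and \<epsilon>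
  where "is_coalg V K" and "\<epsilon> \<in> hom V (Carr K) x"
    and "\<And>(C :: ('o, 'a) coalg) f. is_coalg V C \<Longrightarrow> f \<in> hom V (Carr C) x \<Longrightarrow>
      \<exists>!h. is_coalg_hom V C K h \<and> Comp V \<epsilon> h = f"
proof -
  obtain G where G: "adjunction (Coalg V) V forget_coalg G"
    using adj unfolding has_right_adjoint_def by blast
  have Obj: "Obj (Coalg V) = {C. is_coalg V C}" by (simp add: Coalg_def structured_cat_def)
  obtain \<epsilon> where K: "is_coalg V (OMap G x)" and \<epsilon>: "\<epsilon> \<in> hom V (Carr (OMap G x)) x"
    and univ: "\<And>(C :: ('o, 'a) coalg) f. is_coalg V C \<Longrightarrow> f \<in> hom V (Carr C) x \<Longrightarrow>
      \<exists>!h. h \<in> hom (Coalg V) C (OMap G x) \<and> Comp V \<epsilon> (AMap forget_coalg h) = f"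
    using adjunction_universal_arrow[OF G x] unfolding Obj by (auto simp: forget_coalg_def)
  have "\<exists>!h. is_coalg_hom V C (OMap G x) h \<and> Comp V \<epsilon> h = f"
    if C: "is_coalg V C" and f: "f \<in> hom V (Carr C) x"
    for C :: "('o, 'a) coalg" and f
    using univ[OF C f] by (simp add: ex1_hom_Coalg[OF C K] forget_coalg_def)
  with K \<epsilon> show thesis by (rule that)
qed

lemma terminal_measuring_cat:
  "terminal (measuring_cat V E A B I M) (W, \<omega>) \<longleftrightarrow> measures V E A B I M W \<omega> \<and>
    (\<forall>C \<psi>. measures V E A B I M C \<psi> \<longrightarrow> (\<exists>!g. is_coalg_hom V C W g \<and> Comp V \<omega> g = \<psi>))"
proof -
  have Obj: "(C, \<psi>) \<in> Obj (measuring_cat V E A B I M) \<longleftrightarrow> measures V E A B I M C \<psi>" for C \<psi>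
    by (simp add: measuring_cat_def structured_cat_def)
  have hom: "hom (measuring_cat V E A B I M) (C, \<psi>) (W, \<omega>) =
      (\<lambda>g. ((C, \<psi>), (W, \<omega>), g)) ` {g. is_coalg_hom V C W g \<and> Comp V \<omega> g = \<psi>}"
    if "measures V E A B I M C \<psi>" "measures V E A B I M W \<omega>" for C \<psi>
    using that
    by (auto simp: hom_def measuring_cat_def structured_cat_def is_coalg_hom_def)
  show ?thesis
    by (simp add: terminal_def Ball_def Obj hom ex1_tagged[where Q = "\<lambda>x. True", simplified]
        cong: conj_cong)
qed

theorem theorem2p2p8:
  fixes V :: "('o, 'a) smcat"
    and E :: "('c, 'o, 'a) ecat"
    and A B :: 'c
    and I :: "'i set"
    and M :: "'i \<Rightarrow> ('o, 'a) span"
  assumes "symmetric_monoidal V"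
    and "closed_monoidal V"
    and "complete TYPE('u) V"
    and "cocomplete TYPE('u) V"
    and "locally_presentable TYPE('u) V"
    and "has_right_adjoint (Coalg V) V forget_coalg"
    and "complete TYPE('u) (Coalg V)"
    and "cocomplete TYPE('u) (Coalg V)"
    and "locally_presentable TYPE('u) (Coalg V)"
    and "has_right_adjoint (Hopf V) (Bialg V) inclusion_func"
    and "enriched_category V E"
    and "tensored V E"
    and "A \<in> EObj E"
    and "B \<in> EObj E"
    and "is_multispan TYPE('u) V E A B I M"
  shows "\<exists>X. terminal (measuring_cat V E A B I M) X"
proof -
  interpret symmetric_monoidal V by fact
  interpret E: enriched_category V E by fact
  have H: "EHom E A B \<in> Obj V" using assms(13,14) by (rule E.ehom_obj)
  \<comment> \<open>Local presentability supplies an infinite cardinal strictly below that of \<open>'u\<close>.\<close>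
  have inf: "infinite (UNIV :: 'u set)"
  proof -
    obtain l :: "'u rel" where l: "Card_order l" "infinite (Field l)" "l <o |UNIV :: 'u set|"
      using assms(5) unfolding locally_presentable_def cinfinite_def by blast
    have "|Field l| \<le>o |UNIV :: 'u set|"
      using card_of_Field_ordIso[OF l(1)] l(3) ordIso_ordLess_trans ordLess_imp_ordLeq by blast
    then show ?thesis using l(2) card_of_ordLeq_finite by blast
  qed
  have small: "small TYPE('u) I" and span: "\<And>i. i \<in> I \<Longrightarrow> is_span V E A B (M i)"
    using assms(15) by (auto simp: is_multispan_def)
  obtain K :: "('o, 'a) coalg" and \<epsilon> where K: "is_coalg V K" and \<epsilon>: "\<epsilon> \<in> hom V (Carr K) (EHom E A B)"
    and univ: "\<And>(C :: ('o, 'a) coalg) f. is_coalg V C \<Longrightarrow> f \<in> hom V (Carr C) (EHom E A B) \<Longrightarrow>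
      \<exists>!h. is_coalg_hom V C K h \<and> Comp V \<epsilon> h = f"
    using cofree_coalgebra[OF assms(6) H] by metis
  define a where "a i = leg_comp (LShape (M i)) (LLeg (M i)) K \<epsilon>" for i
  define b where "b i = leg_comp (RShape (M i)) (RLeg (M i)) K \<epsilon>" for i
  have ab: "a i \<in> hom V (Carr K) (Target (M i))" "b i \<in> hom V (Carr K) (Target (M i))"
    if "i \<in> I" for i
    using span[OF that] leg_comp_hom[OF K \<epsilon>] by (auto simp: is_span_def a_def b_def)
  have measures_iff: "measures V E A B I M C (\<epsilon> \<cdot>\<^bsub>V\<^esub> h) \<longleftrightarrow> (\<forall>i \<in> I. a i \<cdot>\<^bsub>V\<^esub> h = b i \<cdot>\<^bsub>V\<^esub> h)"
    if C: "is_coalg V C" and h: "is_coalg_hom V C K h"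
      for C :: "('o, 'a) coalg" and h
  proof -
    have "\<epsilon> \<cdot>\<^bsub>V\<^esub> h \<in> hom V (Carr C) (EHom E A B)"
      using h \<epsilon> comp_hom by (auto simp: is_coalg_hom_def)
    moreover have "leg_comp (LShape (M i)) (LLeg (M i)) C (\<epsilon> \<cdot>\<^bsub>V\<^esub> h) = a i \<cdot>\<^bsub>V\<^esub> h"
      "leg_comp (RShape (M i)) (RLeg (M i)) C (\<epsilon> \<cdot>\<^bsub>V\<^esub> h) = b i \<cdot>\<^bsub>V\<^esub> h" if "i \<in> I" for i
      using span[OF that] leg_comp_coalg_hom[OF C K h \<epsilon>]
      unfolding a_def b_def is_span_def by blast+
    ultimately show ?thesis
      using C by (simp add: measures_def Let_def leg_comp_def)
  qed
  \<comment> \<open>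
    The lifts \<open>S\<close>, \<open>R\<close> of \<open>a i\<close>, \<open>b i\<close> to the cofree coalgebra on the target: \<open>S h\<close> and \<open>R h\<close> are the
    unique lifts of \<open>a i h\<close> and \<open>b i h\<close>, so the former agree as soon as the latter do.\<close>
  have "\<exists>S R (T :: ('o, 'a) coalg). is_coalg V T \<and> is_coalg_hom V K T S \<and> is_coalg_hom V K T R \<and>
      (\<forall>(C :: ('o, 'a) coalg) h. is_coalg V C \<longrightarrow> is_coalg_hom V C K h \<longrightarrow>
        (S \<cdot>\<^bsub>V\<^esub> h = R \<cdot>\<^bsub>V\<^esub> h \<longleftrightarrow> a i \<cdot>\<^bsub>V\<^esub> h = b i \<cdot>\<^bsub>V\<^esub> h))" if i: "i \<in> I" for i
  proof -
    have T: "Target (M i) \<in> Obj V" using span[OF i] by (simp add: is_span_def)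
    obtain K' :: "('o, 'a) coalg" and \<epsilon>'
      where K': "is_coalg V K'" and \<epsilon>': "\<epsilon>' \<in> hom V (Carr K') (Target (M i))"
      and univ': "\<And>(C :: ('o, 'a) coalg) f. is_coalg V C \<Longrightarrow> f \<in> hom V (Carr C) (Target (M i)) \<Longrightarrow>
        \<exists>!h. is_coalg_hom V C K' h \<and> Comp V \<epsilon>' h = f"
      using cofree_coalgebra[OF assms(6) T] by metis
    obtain S where S: "is_coalg_hom V K K' S" "\<epsilon>' \<cdot>\<^bsub>V\<^esub> S = a i" using univ'[OF K ab(1)[OF i]] by blast
    obtain R where R: "is_coalg_hom V K K' R" "\<epsilon>' \<cdot>\<^bsub>V\<^esub> R = b i" using univ'[OF K ab(2)[OF i]] by blast
    have "S \<cdot>\<^bsub>V\<^esub> h = R \<cdot>\<^bsub>V\<^esub> h \<longleftrightarrow> a i \<cdot>\<^bsub>V\<^esub> h = b i \<cdot>\<^bsub>V\<^esub> h"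
      if C: "is_coalg V C" and h: "is_coalg_hom V C K h"
      for C :: "('o, 'a) coalg" and h
    proof -
      have h': "h \<in> hom V (Carr C) (Carr K)" using h by (simp add: is_coalg_hom_def)
      have S': "S \<in> hom V (Carr K) (Carr K')" and R': "R \<in> hom V (Carr K) (Carr K')"
        using S R by (simp_all add: is_coalg_hom_def)
      have Sh: "\<epsilon>' \<cdot>\<^bsub>V\<^esub> S \<cdot>\<^bsub>V\<^esub> h = a i \<cdot>\<^bsub>V\<^esub> h" using comp_assoc[OF h' S' \<epsilon>'] S(2) by simp
      have Rh: "\<epsilon>' \<cdot>\<^bsub>V\<^esub> R \<cdot>\<^bsub>V\<^esub> h = b i \<cdot>\<^bsub>V\<^esub> h" using comp_assoc[OF h' R' \<epsilon>'] R(2) by simp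
      have "a i \<cdot>\<^bsub>V\<^esub> h \<in> hom V (Carr C) (Target (M i))" using comp_hom[OF h' ab(1)[OF i]] .
      from univ'[OF C this] show ?thesis
        using Sh Rh coalg_hom_comp[OF C K K' h S(1)] coalg_hom_comp[OF C K K' h R(1)] by metis
    qed
    then show ?thesis using K' S(1) R(1) by blast
  qed
  then obtain S R and T :: "'i \<Rightarrow> ('o, 'a) coalg" where T: "\<And>i. i \<in> I \<Longrightarrow> is_coalg V (T i)"
    and S: "\<And>i. i \<in> I \<Longrightarrow> is_coalg_hom V K (T i) (S i)"
    and R: "\<And>i. i \<in> I \<Longrightarrow> is_coalg_hom V K (T i) (R i)"
    and SR: "\<And>i (C :: ('o, 'a) coalg) h. i \<in> I \<Longrightarrow> is_coalg V C \<Longrightarrow> is_coalg_hom V C K h \<Longrightarrow>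
      S i \<cdot>\<^bsub>V\<^esub> h = R i \<cdot>\<^bsub>V\<^esub> h \<longleftrightarrow> a i \<cdot>\<^bsub>V\<^esub> h = b i \<cdot>\<^bsub>V\<^esub> h"
    by metis
  have measures_SR: "measures V E A B I M C (\<epsilon> \<cdot>\<^bsub>V\<^esub> h) \<longleftrightarrow> (\<forall>i \<in> I. S i \<cdot>\<^bsub>V\<^esub> h = R i \<cdot>\<^bsub>V\<^esub> h)"
    if "is_coalg V C" "is_coalg_hom V C K h"
      for C :: "('o, 'a) coalg" and h
    using measures_iff[OF that] SR that by auto
  have KO: "K \<in> Obj (Coalg V)" using K by (simp add: Coalg_def structured_cat_def)
  have SC: "(K, T i, S i) \<in> hom (Coalg V) K (T i)" and RC: "(K, T i, R i) \<in> hom (Coalg V) K (T i)"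
    if "i \<in> I" for i
    using that K T S R by (auto simp: hom_Coalg)
  obtain W p' where p': "p' \<in> hom (Coalg V) W K"
    and p'eq: "\<And>i. i \<in> I \<Longrightarrow> Comp (Coalg V) (K, T i, S i) p' = Comp (Coalg V) (K, T i, R i) p'"
    and lim: "\<And>C h. h \<in> hom (Coalg V) C K \<Longrightarrow>
      (\<And>i. i \<in> I \<Longrightarrow> Comp (Coalg V) (K, T i, S i) h = Comp (Coalg V) (K, T i, R i) h) \<Longrightarrow>
      \<exists>!g. g \<in> hom (Coalg V) C W \<and> Comp (Coalg V) p' g = h"
    by (rule complete_has_joint_equalizers[OF assms(7) inf small KO SC RC]) blast+
  obtain p where p'_def: "p' = (W, K, p)" and W: "is_coalg V W" and p: "is_coalg_hom V W K p"
    using p' by (auto simp: hom_Coalg)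
  have equalizer: "\<exists>!g. is_coalg_hom V C W g \<and> p \<cdot>\<^bsub>V\<^esub> g = h"
    if C: "is_coalg V C" and h: "is_coalg_hom V C K h"
      and eq: "\<forall>i \<in> I. S i \<cdot>\<^bsub>V\<^esub> h = R i \<cdot>\<^bsub>V\<^esub> h"
      for C :: "('o, 'a) coalg" and h
  proof -
    have "\<exists>!g. g \<in> hom (Coalg V) C W \<and> Comp (Coalg V) p' g = (C, K, h)"
      using C K h eq by (intro lim) (simp_all add: hom_Coalg Comp_Coalg)
    then show ?thesis by (simp add: ex1_hom_Coalg[OF C W] p'_def Comp_Coalg)
  qed
  have W_measures: "measures V E A B I M W (\<epsilon> \<cdot>\<^bsub>V\<^esub> p)"
    using measures_SR[OF W p] p'eq by (auto simp: Comp_Coalg p'_def)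
  have "\<exists>!g. is_coalg_hom V C W g \<and> (\<epsilon> \<cdot>\<^bsub>V\<^esub> p) \<cdot>\<^bsub>V\<^esub> g = \<psi>"
    if m: "measures V E A B I M C \<psi>" for C \<psi>
  proof -
    have C: "is_coalg V C" and \<psi>: "\<psi> \<in> hom V (Carr C) (EHom E A B)"
      using m by (simp_all add: measures_def)
    obtain h where h: "is_coalg_hom V C K h" "\<epsilon> \<cdot>\<^bsub>V\<^esub> h = \<psi>"
      and h_unique: "\<And>h'. is_coalg_hom V C K h' \<Longrightarrow> \<epsilon> \<cdot>\<^bsub>V\<^esub> h' = \<psi> \<Longrightarrow> h' = h"
      using univ[OF C \<psi>] by blast
    have ex: "\<exists>!g. is_coalg_hom V C W g \<and> p \<cdot>\<^bsub>V\<^esub> g = h"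
      using equalizer[OF C h(1)] measures_SR[OF C h(1)] m h(2) by simp
    have "(\<epsilon> \<cdot>\<^bsub>V\<^esub> p) \<cdot>\<^bsub>V\<^esub> g = \<psi> \<longleftrightarrow> p \<cdot>\<^bsub>V\<^esub> g = h" if g: "is_coalg_hom V C W g" for g
    proof -
      have "(\<epsilon> \<cdot>\<^bsub>V\<^esub> p) \<cdot>\<^bsub>V\<^esub> g = \<epsilon> \<cdot>\<^bsub>V\<^esub> p \<cdot>\<^bsub>V\<^esub> g"
        using p g comp_assoc[OF _ _ \<epsilon>] by (auto simp: is_coalg_hom_def)
      then show ?thesis
        using h(2) h_unique[OF coalg_hom_comp[OF C W K g p]] by auto
    qed
    then show ?thesis using ex by (simp cong: conj_cong)
  qed
  then have "terminal (measuring_cat V E A B I M) (W, \<epsilon> \<cdot>\<^bsub>V\<^esub> p)"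
    using W_measures by (simp add: terminal_measuring_cat)
  then show ?thesis by blast
qed

end
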